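(* Let $b>1$ and $k\ge 1$ be integers, and let $v_i=k$ for $i=2,\dots,b$. Then $v_1$ is determined by the relation $$2^{v_1-k}(2^k-3)\equiv 1 \pmod{3^b},$$ that is, for a positive integer $v_1$, the tuple $(b,v_1,k,\dots,k)$ (with $k$ repeated $b-1$ times) is admissible if and only if this congruence holds, where $2^{v_1-k}$ is understood modulo $3^b$ (using the inverse of $2$ modulo $3^b$ when $v_1<k$).
   Context: A tuple $(b,u_0>u_1>\dots>u_b=0)$ of integers with $b\ge 1$ and $u_0\ge b\frac{\log 3}{\log 2}$ is called admissible if $\frac{2^{u_0}}{3^b}-\sum_{i=1}^{b}\frac{2^{u_i}}{3^{b-i+1}}\in\mathbb{N}$. In the alternative notation, $(b,v_1,\dots,v_b)$ with positive integers $v_i$ stands for the tuple $(b,u_0>\dots>u_b=0)$ with $v_i=u_{i-1}-u_i$, i.e. $u_i=\sum_{l=i+1}^b v_l$. *)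

theory Defs
  imports Complex_Main "HOL-Number_Theory.Number_Theory"
begin

(* A tuple (b, u_0 > ... > u_b = 0) is given by b and a function u, of which only the
   values at 0, ..., b matter.  The value in question is never 0 on such tuples (the u_i
   with i < b are positive), so it is irrelevant whether 0 counts as a natural number. *)
definition admissible :: "nat \<Rightarrow> (nat \<Rightarrow> int) \<Rightarrow> bool" where
  "admissible b u \<longleftrightarrow>
     b \<ge> 1 \<and> (\<forall>i<b. u (Suc i) < u i) \<and> u b = 0 \<and>
     real_of_int (u 0) \<ge> real b * (ln 3 / ln 2) \<and>
     (2::real) powi u 0 / 3 ^ b - (\<Sum>i=1..b. 2 powi u i / 3 ^ (b - i + 1)) \<in> \<nat>"

(* The exponents u_i of the tuple written (b, v_1, ..., v_b) in terms of the differences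
   v_i = u_{i-1} - u_i; only the values of v at 1, ..., b matter.  Positivity of the v_i
   is the strict decrease required by admissible. *)
definition exponents_of_gaps :: "nat \<Rightarrow> (nat \<Rightarrow> int) \<Rightarrow> nat \<Rightarrow> int" where
  "exponents_of_gaps b v i = (\<Sum>l=i+1..b. v l)"

(* A representative of a^e modulo m for an integer exponent e, where a is coprime to m. *)
definition powi_mod :: "int \<Rightarrow> int \<Rightarrow> int \<Rightarrow> int" where
  "powi_mod m a e = (if e \<ge> 0 then a ^ nat e else modular_inverse m a ^ nat (- e))"

end

theory Submission
  imports Defs
begin

text \<open>
  Put \<open>q = 2^k\<close> and \<open>u = v\<^sub>1 + (b - 1)k\<close>. The sum in the admissibility condition is geometric, so the
  number in question is \<open>(2^u - S) / 3^b\<close> with \<open>(q - 3) S = q^b - 3^b\<close>. As \<open>q - 3\<close> and \<open>2\<close> are units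
  modulo \<open>3^b\<close>, divisibility of \<open>2^u - S\<close> by \<open>3^b\<close> is equivalent to \<open>2^v\<^sub>1 (q - 3) = q\<close> modulo \<open>3^b\<close>.
  This congruence already forces \<open>3^b \<le> 2^u\<close> and \<open>S \<le> 2^u\<close>: this is clear if \<open>k \<le> v\<^sub>1\<close> and \<open>k \<noteq> 1\<close>;
  for \<open>k = 1\<close> it says that \<open>3^b\<close> divides \<open>2^(v\<^sub>1 - 1) + 1\<close>, and for \<open>v\<^sub>1 < k\<close> that \<open>3^b\<close> divides the odd
  number \<open>q - 3 - 2^(k - v\<^sub>1)\<close>, whence \<open>q > 3^b\<close>.
\<close>

text \<open>This is the \<open>S\<close> of the overview, kept as a sum so that it is visibly an
  integer; dividing \<open>q ^ b - 3 ^ b\<close> by \<open>q - 3\<close> would hide this.\<close>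

definition geometric_numerator :: "nat \<Rightarrow> int \<Rightarrow> int" where
  "geometric_numerator b q = (\<Sum>j<b. q ^ j * 3 ^ (b - 1 - j))"

lemma geometric_numerator_mult: "(q - 3) * geometric_numerator b q = q ^ b - 3 ^ b"
proof (cases b)
  case (Suc n)
  have "q ^ Suc n - 3 ^ Suc n = (q - 3) * (\<Sum>p<Suc n. q ^ p * 3 ^ (n - p))"
    by (rule diff_power_eq_sum)
  then show ?thesis
    by (simp only: Suc geometric_numerator_def diff_Suc_1)
qed (simp add: geometric_numerator_def)

text \<open>Multiplying by the unit \<open>a ^ k\<close> clears a possible inverse of
  \<open>a\<close>, so that only natural exponents remain.\<close>

lemma cong_powi_mod_iff:
  fixes m a x :: int and w k :: nat
  assumes "coprime a m"
  shows "[powi_mod m a (int w - int k) * x = 1] (mod m) \<longleftrightarrow> [a ^ w * x = a ^ k] (mod m)"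
proof -
  have "[a ^ k * powi_mod m a (int w - int k) = a ^ w] (mod m)"
  proof (cases "k \<le> w")
    case True
    then have "a ^ k * powi_mod m a (int w - int k) = a ^ w"
      by (simp add: powi_mod_def nat_diff_distrib flip: power_add)
    then show ?thesis by simp
  next
    case False
    then have k: "k = w + (k - w)" and p: "powi_mod m a (int w - int k) = modular_inverse m a ^ (k - w)"
      by (simp_all add: powi_mod_def nat_diff_distrib)
    have "[a * modular_inverse m a = 1] (mod m)"
      using assms by (metis cong_modular_inverse1)
    then have "[(a * modular_inverse m a) ^ (k - w) = 1] (mod m)"
      using cong_pow by fastforce
    then have "[a ^ w * (a * modular_inverse m a) ^ (k - w) = a ^ w * 1] (mod m)"
      by (rule cong_scalar_left)
    moreover have "a ^ k * modular_inverse m a ^ (k - w) = a ^ w * (a * modular_inverse m a) ^ (k - w)"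
      \<comment> \<open>Of the \<open>k\<close> factors \<open>a\<close>, exactly
        \<open>k - w\<close> pair off with inverses and \<open>w\<close> are left over.\<close>
      by (subst k) (simp only: power_add power_mult_distrib mult.assoc)
    ultimately show ?thesis by (simp add: p)
  qed
  then have "[a ^ k * powi_mod m a (int w - int k) * x = a ^ w * x] (mod m)"
    by (rule cong_scalar_right)
  moreover have "[powi_mod m a (int w - int k) * x = 1] (mod m) \<longleftrightarrow>
      [a ^ k * (powi_mod m a (int w - int k) * x) = a ^ k * 1] (mod m)"
    using assms by (intro cong_mult_lcancel[symmetric]) simp
  ultimately show ?thesis
    by (simp add: cong_def mult.assoc)
qed

lemma coprime_two_power_minus_three: "coprime ((2::int) ^ k - 3) (3 ^ b)"
proof -
  have "coprime ((2::int) ^ k) 3" by simp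
  then have "coprime ((2::int) ^ k - 3) 3"
    by (metis coprime_iff_gcd_eq_1 gcd_diff1)
  then show ?thesis by simp
qed

text \<open>Multiplying by the unit \<open>2 ^ k - 3\<close> replaces the geometric sum by its
  closed form; the unit \<open>2 ^ ((b - 1) * k)\<close> then factors out modulo
  \<open>3 ^ b\<close>.\<close>

lemma dvd_numerator_iff:
  fixes b k w :: nat
  assumes "b \<ge> 1"
  shows "3 ^ b dvd 2 ^ (w + (b - 1) * k) - geometric_numerator b (2 ^ k) \<longleftrightarrow>
    [2 ^ w * (2 ^ k - 3) = (2::int) ^ k] (mod 3 ^ b)"
proof -
  let ?q = "(2::int) ^ k" and ?S = "geometric_numerator b (2 ^ k)"
  let ?u = "w + (b - 1) * k"
  have qb: "?q ^ b = 2 ^ ((b - 1) * k) * ?q"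
    using assms by (cases b) (simp_all add: power_mult[symmetric] power_add[symmetric] algebra_simps)
  have "3 ^ b dvd 2 ^ ?u - ?S \<longleftrightarrow> 3 ^ b dvd (?q - 3) * (2 ^ ?u - ?S)"
    using coprime_two_power_minus_three[of k b]
    by (simp add: coprime_commute coprime_dvd_mult_right_iff)
  also have "(?q - 3) * (2 ^ ?u - ?S) = 2 ^ ((b - 1) * k) * (2 ^ w * (?q - 3) - ?q) + 3 ^ b"
    using geometric_numerator_mult[of ?q b] qb by (simp add: algebra_simps power_add)
  also have "3 ^ b dvd \<dots> \<longleftrightarrow> 3 ^ b dvd 2 ^ ((b - 1) * k) * (2 ^ w * (?q - 3) - ?q)"
    by (metis dvd_add_left_iff dvd_refl)
  also have "\<dots> \<longleftrightarrow> 3 ^ b dvd 2 ^ w * (?q - 3) - ?q"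
    by (rule coprime_dvd_mult_right_iff) simp
  finally show ?thesis by (simp add: cong_iff_dvd_diff)
qed

text \<open>Admissibility also asks for the logarithmic bound and for a nonnegative value; this
  shows that the congruence alone supplies both.\<close>

lemma cong_imp_bounds:
  fixes b k w :: nat
  assumes b: "b \<ge> 2" and k: "k \<ge> 1" and w: "w \<ge> 1"
    and cong: "[2 ^ w * (2 ^ k - 3) = (2::int) ^ k] (mod 3 ^ b)"
  shows "(3::int) ^ b \<le> 2 ^ (w + (b - 1) * k)"
    and "geometric_numerator b (2 ^ k) \<le> 2 ^ (w + (b - 1) * k)"
proof -
  let ?q = "(2::int) ^ k" and ?S = "geometric_numerator b (2 ^ k)"
  let ?u = "w + (b - 1) * k"
  have S: "(?q - 3) * ?S = ?q ^ b - 3 ^ b" by (rule geometric_numerator_mult)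
  have nine: "(9::int) \<le> 3 ^ b"
    using power_increasing[of 2 b "3::int"] b by simp
  have "3 ^ b \<le> (2::int) ^ ?u \<and> ?S \<le> 2 ^ ?u"
  proof (cases "k = 1")
    case True
    obtain t where t: "w = Suc t" using w by (cases w) auto
    have "3 ^ b dvd 2 ^ w * (?q - 3) - ?q"
      using cong by (simp only: cong_iff_dvd_diff)
    also have "2 ^ w * (?q - 3) - ?q = - (2 * (2 ^ t + 1))"
      by (simp add: True t)
    finally have "3 ^ b dvd (2::int) * (2 ^ t + 1)"
      by (simp only: dvd_minus_iff)
    then have "3 ^ b dvd (2::int) ^ t + 1"
      by (subst (asm) coprime_dvd_mult_right_iff) simp_all
    then have "(3::int) ^ b \<le> 2 ^ t + 1"
      by (rule zdvd_imp_le) simp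
    \<comment> \<open>Doubling the previous bound gives
      \<open>2 ^ ?u \<ge> 2 * 3 ^ b - 2 \<ge> 3 ^ b\<close>, and \<open>?S\<close> lies below
      \<open>3 ^ b\<close>.\<close>
    moreover have "(2::int) ^ t * 2 \<le> 2 ^ ?u"
      using power_increasing[of "Suc t" ?u "2::int"] by (simp add: t)
    moreover have "?S = 3 ^ b - 2 ^ b" using S by (simp add: True)
    moreover have "(0::int) < 2 ^ b" by simp
    ultimately show ?thesis using nine by linarith
  next
    case False
    with k have k2: "k \<ge> 2" by simp
    have q4: "4 \<le> ?q" using power_increasing[of 2 k "2::int"] k2 by simp
    have qb: "?q ^ b = ?q ^ (b - 1) * ?q"
      using b by (cases b) simp_all
    have u: "(2::int) ^ ?u = 2 ^ w * ?q ^ (b - 1)"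
      by (simp add: power_add power_mult[symmetric] mult.commute)
    \<comment> \<open>By \<open>S\<close>, the second conjunct bounds \<open>(?q - 3) * ?S\<close>,
      and the positive factor \<open>?q - 3\<close> cancels.\<close>
    have key: "3 ^ b \<le> (2::int) ^ ?u \<and> ?q ^ b \<le> (?q - 3) * 2 ^ ?u"
    proof (cases "k \<le> w")
      case True
      then have "?q \<le> 2 ^ w" by (simp add: power_increasing)
      then have le: "?q ^ b \<le> 2 ^ ?u"
        unfolding u qb by (subst mult.commute) (simp add: mult_right_mono)
      moreover have "(3::int) ^ b \<le> ?q ^ b" using q4 by (intro power_mono) auto
      moreover have "1 * (2::int) ^ ?u \<le> (?q - 3) * 2 ^ ?u"
        using q4 by (intro mult_right_mono) auto
      ultimately show ?thesis by linarith
    next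
      case False
      define d where "d = k - w"
      have kd: "?q = 2 ^ w * 2 ^ d" using False by (simp add: d_def flip: power_add)
      have "[2 ^ w * (?q - 3) = 2 ^ w * 2 ^ d] (mod 3 ^ b)"
        using cong kd by simp
      then have "[?q - 3 = 2 ^ d] (mod 3 ^ b)"
        by (subst (asm) cong_mult_lcancel) simp_all
      then have dv: "3 ^ b dvd ?q - 3 - 2 ^ d" by (simp add: cong_iff_dvd_diff)
      have "2 * (2::int) ^ d \<le> 2 ^ w * 2 ^ d"
        using w power_increasing[of 1 w "2::int"] by (intro mult_right_mono) auto
      then have half: "2 * 2 ^ d \<le> ?q" using kd by simp
      \<comment> \<open>Both powers are even, as \<open>w < k\<close> makes \<open>d\<close>
        positive. Parity thus excludes the multiple 0 of \<open>3 ^ b\<close>.\<close>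
      have "odd (?q - 3 - 2 ^ d)" using False k2 by (simp add: d_def)
      then have ne: "?q - 3 - 2 ^ d \<noteq> 0" by (metis even_zero)
      have "3 ^ b < ?q"
      proof (cases "?q - 3 - 2 ^ d > 0")
        case True
        with dv have "3 ^ b \<le> ?q - 3 - 2 ^ d" by (rule zdvd_imp_le)
        moreover have "(0::int) < 2 ^ d" by simp
        ultimately show ?thesis by linarith
      next
        case False
        \<comment> \<open>This sign is impossible: by \<open>half\<close>, twice the negated value
          is at most \<open>6 - ?q \<le> 2\<close>, whereas \<open>3 ^ b \<ge> 9\<close>.\<close>
        have "3 ^ b dvd - (?q - 3 - 2 ^ d)" using dv by (simp only: dvd_minus_iff)
        moreover have "- (?q - 3 - 2 ^ d) > 0" using False ne by linarith
        ultimately have "3 ^ b \<le> - (?q - 3 - 2 ^ d)" by (rule zdvd_imp_le)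
        with half nine q4 show ?thesis by linarith
      qed
      moreover have w2: "2 * ?q ^ (b - 1) \<le> 2 ^ ?u"
        unfolding u using w power_increasing[of 1 w "2::int"] by (intro mult_right_mono) auto
      moreover have "?q ^ 1 \<le> ?q ^ (b - 1)"
        using b q4 by (intro power_increasing) auto
      moreover have "?q ^ b \<le> (?q - 3) * 2 ^ ?u"
      proof -
        \<comment> \<open>The inequality \<open>?q \<le> 2 * (?q - 3)\<close> needs
          \<open>?q \<ge> 6\<close>, which follows from \<open>?q > 3 ^ b \<ge> 9\<close>; the
          factor 2 is then absorbed by \<open>2 ^ w\<close>.\<close>
        have "?q * ?q ^ (b - 1) \<le> ((?q - 3) * 2) * ?q ^ (b - 1)"
          using \<open>3 ^ b < ?q\<close> nine by (intro mult_right_mono) auto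
        also have "\<dots> = (?q - 3) * (2 * ?q ^ (b - 1))" by simp
        also have "\<dots> \<le> (?q - 3) * 2 ^ ?u"
          using w2 q4 by (intro mult_left_mono) auto
        finally show ?thesis by (simp add: qb mult.commute)
      qed
      ultimately show ?thesis using nine q4 by simp
    qed
    then have "(?q - 3) * ?S \<le> (?q - 3) * 2 ^ ?u"
      unfolding S using zero_le_power[of "3::int" b] by linarith
    then have "?S \<le> 2 ^ ?u" using q4 by (subst (asm) mult_le_cancel_left_pos) auto
    with key show ?thesis by simp
  qed
  then show "3 ^ b \<le> (2::int) ^ ?u" and "?S \<le> 2 ^ ?u" by auto
qed

lemma divide_in_Nats_iff:
  fixes a m :: int
  assumes "m > 0"
  shows "real_of_int a / real_of_int m \<in> \<nat> \<longleftrightarrow> m dvd a \<and> 0 \<le> a"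
proof
  assume "real_of_int a / real_of_int m \<in> \<nat>"
  then obtain n where "real_of_int a / real_of_int m = real n" by (auto elim: Nats_cases)
  then have "real_of_int a = real_of_int (m * int n)" using assms by (simp add: field_simps)
  then have "a = m * int n" by (simp only: of_int_eq_iff)
  then show "m dvd a \<and> 0 \<le> a" using assms by simp
next
  assume "m dvd a \<and> 0 \<le> a"
  then obtain c where c: "a = m * c" and "0 \<le> m * c" by auto
  with assms have "0 \<le> c" by (simp add: zero_le_mult_iff)
  then have "real_of_int a / real_of_int m = real (nat c)" using assms c by simp
  then show "real_of_int a / real_of_int m \<in> \<nat>" by (metis of_nat_in_Nats)
qed

lemma log_bound_iff:
  "real b * (ln 3 / ln 2) \<le> real u \<longleftrightarrow> (3::int) ^ b \<le> 2 ^ u"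
proof -
  have "real b * (ln 3 / ln 2) \<le> real u \<longleftrightarrow> ln ((3::real) ^ b) \<le> ln (2 ^ u)"
    by (simp add: field_simps ln_realpow)
  also have "\<dots> \<longleftrightarrow> (3::real) ^ b \<le> 2 ^ u" by simp
  also have "\<dots> \<longleftrightarrow> real_of_int (3 ^ b) \<le> real_of_int (2 ^ u)" by simp
  also have "\<dots> \<longleftrightarrow> (3::int) ^ b \<le> 2 ^ u" by (rule of_int_le_iff)
  finally show ?thesis .
qed

text \<open>Only \<open>u_0\<close> involves \<open>v 1\<close>; for \<open>i \<ge> 1\<close> the
  exponent is \<open>(b - i) * k\<close>, so the sum is geometric. Over the common denominator
  \<open>3 ^ b\<close>, admissibility becomes a statement about integers.\<close>

lemma admissible_constant_gaps_iff:
  fixes b k w :: nat and v :: "nat \<Rightarrow> int"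
  assumes b: "b \<ge> 1" and k: "k \<ge> 1" and w: "w \<ge> 1"
    and v1: "v 1 = int w" and v: "\<And>i. i \<in> {2..b} \<Longrightarrow> v i = int k"
  shows "admissible b (exponents_of_gaps b v) \<longleftrightarrow>
    (3::int) ^ b \<le> 2 ^ (w + (b - 1) * k) \<and>
    3 ^ b dvd 2 ^ (w + (b - 1) * k) - geometric_numerator b (2 ^ k) \<and>
    geometric_numerator b (2 ^ k) \<le> 2 ^ (w + (b - 1) * k)"
proof -
  let ?e = "exponents_of_gaps b v" and ?u = "w + (b - 1) * k"
  have e: "?e i = int ((b - i) * k)" if "i \<ge> 1" for i
  proof -
    have "?e i = (\<Sum>l=i+1..b. int k)"
      unfolding exponents_of_gaps_def using that by (intro sum.cong refl v) auto
    then show ?thesis by simp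
  qed
  have e0: "?e 0 = int ?u"
  proof -
    have "?e 0 = v 1 + ?e 1"
      unfolding exponents_of_gaps_def using b by (simp add: sum.atLeast_Suc_atMost)
    then show ?thesis using e[of 1] v1 by simp
  qed
  have dec: "?e (Suc i) < ?e i" if "i < b" for i
  proof (cases "i = 0")
    case True
    then show ?thesis using e0 e[of 1] w by simp
  next
    case False
    then have "b - i = Suc (b - Suc i)" using that by simp
    then show ?thesis using e[of i] e[of "Suc i"] False k by simp
  qed
  have "(\<Sum>i=1..b. (2::real) powi ?e i / 3 ^ (b - i + 1)) =
      (\<Sum>i=1..b. (2 ^ k) ^ (b - i) / 3 ^ (b - i + 1))"
  proof (intro sum.cong refl)
    fix i assume "i \<in> {1..b}"
    then have "?e i = int (k * (b - i))" by (simp add: e)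
    then show "(2::real) powi ?e i / 3 ^ (b - i + 1) = (2 ^ k) ^ (b - i) / 3 ^ (b - i + 1)"
      by (simp only: power_int_of_nat power_mult)
  qed
  also have "\<dots> = (\<Sum>j<b. (2 ^ k) ^ j / 3 ^ (j + 1))"
    by (rule sum.reindex_bij_witness[of _ "\<lambda>j. b - j" "\<lambda>i. b - i"]) auto
  also have "\<dots> = (\<Sum>j<b. (2 ^ k) ^ j * 3 ^ (b - 1 - j) / 3 ^ b)"
  proof (intro sum.cong refl)
    fix j assume "j \<in> {..<b}"
    then have "(3::real) ^ b = 3 ^ (j + 1) * 3 ^ (b - 1 - j)" by (simp flip: power_add power_Suc)
    then show "(2 ^ k) ^ j / 3 ^ (j + 1) = (2 ^ k) ^ j * (3::real) ^ (b - 1 - j) / 3 ^ b"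
      by simp
  qed
  also have "\<dots> = real_of_int (geometric_numerator b (2 ^ k)) / 3 ^ b"
    by (simp add: geometric_numerator_def sum_divide_distrib)
  finally have "2 powi ?e 0 / 3 ^ b - (\<Sum>i=1..b. (2::real) powi ?e i / 3 ^ (b - i + 1)) =
      real_of_int (2 ^ ?u - geometric_numerator b (2 ^ k)) / real_of_int (3 ^ b)"
    unfolding e0 power_int_of_nat by (simp add: diff_divide_distrib)
  then have "admissible b ?e \<longleftrightarrow> real b * (ln 3 / ln 2) \<le> real ?u \<and>
      real_of_int (2 ^ ?u - geometric_numerator b (2 ^ k)) / real_of_int (3 ^ b) \<in> \<nat>"
    unfolding admissible_def using b dec e[of b] e0 by simp
  then show ?thesis
    by (simp only: log_bound_iff divide_in_Nats_iff[of "3 ^ b"] zero_less_power zero_less_numeral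
        diff_ge_0_iff_ge)
qed

theorem proposition2:
  fixes b :: nat and k :: int and v :: "nat \<Rightarrow> int"
  assumes "b > 1" and "k \<ge> 1"
    and "v 1 > 0"
    and "\<And>i. i \<in> {2..b} \<Longrightarrow> v i = k"
  shows "admissible b (exponents_of_gaps b v) \<longleftrightarrow>
    [powi_mod (3 ^ b) 2 (v 1 - k) * (2 ^ nat k - 3) = 1] (mod 3 ^ b)"
proof -
  define w n where "w = nat (v 1)" and "n = nat k"
  have v1: "v 1 = int w" and k: "k = int n" and w: "w \<ge> 1" and n: "n \<ge> 1"
    using assms(2,3) by (simp_all add: w_def n_def)
  \<comment> \<open>Of the three integer conditions, divisibility is equivalent to the congruence,
    which in turn implies the two inequalities.\<close>
  have "admissible b (exponents_of_gaps b v) \<longleftrightarrow> [2 ^ w * (2 ^ n - 3) = (2::int) ^ n] (mod 3 ^ b)"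
    using admissible_constant_gaps_iff[of b n w v] dvd_numerator_iff[of b w n]
      cong_imp_bounds[of b n w] assms(1,4) v1 k w n by fastforce
  also have "\<dots> \<longleftrightarrow> [powi_mod (3 ^ b) 2 (int w - int n) * (2 ^ n - 3) = 1] (mod 3 ^ b)"
    by (rule cong_powi_mod_iff[symmetric]) simp
  finally show ?thesis by (simp only: v1 k nat_int)
qed

end
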